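(* Let $k\ge3$ and $a\in\mathbb{N}$ with $a\ge1$, and set $B=(a.0)$. Then, as formal power series, \[ C_B^{(k)}(y)=y^a\,G_{k-1}(y). \]
   Context: Words are over the alphabet $\mathbb{N}=\{0,1,2,\dots\}$; $(x.y)$ denotes the length-2 word with letters $x,y$. For $k\ge 2$, $\phi_k$ is the morphism of $\mathbb{N}^*$ defined for $i\in\mathbb{N}$, $0\le j\le k-1$ by $\phi_k(ki+j)=(ki)(ki+j+1)$ if $0\le j\le k-2$ and $\phi_k(ki+k-1)=ki+k$; $W_n^{(k)}=\phi_k^n(0)$. For a nonempty word $B$, $c^{(k)}(B;n)$ is the number of (possibly overlapping) occurrences of $B$ in $W_n^{(k)}$ and $C_B^{(k)}(y)=\sum_{n\ge0}c^{(k)}(B;n)y^n$. For $m\ge2$, the sequence $(g_n^{(m)})_{n\ge0}$ is defined by $g_0^{(m)}=0$, $g_n^{(m)}=2^{n-1}$ for $1\le n\le m-1$, and $g_n^{(m)}=g_{n-1}^{(m)}+\cdots+g_{n-m}^{(m)}$ for $n\ge m$; $G_m(y)=\sum_{n\ge0}g_n^{(m)}y^n$ (equivalently $G_m(y)=(1-y^m)/(1-y-\cdots-y^m)-1$). *)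

theory Defs
  imports "HOL-Computational_Algebra.Formal_Power_Series"
begin

text \<open>
  Words over the natural numbers are lists. A letter \<open>a\<close> is written uniquely as \<open>a = k * i + j\<close> with
  \<open>i = a div k\<close> and \<open>j = a mod k\<close>; the parameter \<open>k\<close> is meant to satisfy \<open>k \<ge> 2\<close>.
\<close>

definition phi_letter :: "nat \<Rightarrow> nat \<Rightarrow> nat list" where
  "phi_letter k a =
     (let i = a div k; j = a mod k
      in if j = k - 1 then [k * i + k] else [k * i, k * i + j + 1])"

definition phi :: "nat \<Rightarrow> nat list \<Rightarrow> nat list" where
  "phi k w = concat (map (phi_letter k) w)"

definition W :: "nat \<Rightarrow> nat \<Rightarrow> nat list" where
  "W k n = (phi k ^^ n) [0]"

text \<open>Occurrences are counted by starting position, so overlapping ones count separately.\<close>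

definition occurrences :: "'a list \<Rightarrow> 'a list \<Rightarrow> nat" where
  "occurrences B w = card {p. p + length B \<le> length w \<and> take (length B) (drop p w) = B}"

definition C :: "nat \<Rightarrow> nat list \<Rightarrow> int fps" where
  "C k B = Abs_fps (\<lambda>n. int (occurrences B (W k n)))"

function g :: "nat \<Rightarrow> nat \<Rightarrow> nat" where
  "g m n = (if n = 0 then 0
            else if n < m then 2 ^ (n - 1)
            else (\<Sum>i = 1..m. g m (n - i)))"
  by pat_completeness auto
termination
  by (relation "measure snd") auto

declare g.simps [simp del]

definition G :: "nat \<Rightarrow> int fps" where
  "G m = Abs_fps (\<lambda>n. int (g m n))"

end

theory Submission
  imports Defs
begin

unbundle fps_syntax

text \<open>
  Since the image of \<open>j < k - 1\<close> is \<open>0 (j + 1)\<close>, the \<open>n\<close>-th iterate on \<open>j\<close> is \<open>W\<^sub>n\<^sub>-\<^sub>1\<close> followed by the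
  \<open>(n-1)\<close>-st iterate on \<open>j + 1\<close>, and the iterates on \<open>k - 1\<close> never contain \<open>0\<close>. As \<open>W\<^sub>n\<close> ends in the
  letter \<open>n\<close>, an occurrence of \<open>(a.0)\<close> straddles this cut only if \<open>n - 1 = a\<close> and \<open>j + 1 < k - 1\<close>.
  Unrolling this from \<open>j = 0\<close> to \<open>j = k - 1\<close> gives, with \<open>S\<^sub>r = y + \<dots> + y\<^sup>r\<close>, the equation
  \<open>C = S\<^sub>k\<^sub>-\<^sub>1 C + S\<^sub>k\<^sub>-\<^sub>2 y\<^sup>a\<close>, whose unique solution is \<open>y\<^sup>a G\<^sub>k\<^sub>-\<^sub>1\<close>.
\<close>

section \<open>Occurrences of a two-letter word\<close>

lemma occurrences_pair_alt:
  "occurrences [a, b] w = card {p. Suc p < length w \<and> w ! p = a \<and> w ! Suc p = b}"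
proof -
  have "take 2 (drop p w) = [w ! p, w ! Suc p]" if "Suc p < length w" for p
    using that by (simp add: numeral_2_eq_2 Cons_nth_drop_Suc[symmetric])
  then show ?thesis
    unfolding occurrences_def by (intro arg_cong[where f = card]) (auto simp: numeral_2_eq_2)
qed

lemma occurrences_pair_Nil [simp]: "occurrences [a, b] [] = 0"
  by (simp add: occurrences_pair_alt)

lemma occurrences_pair_Cons:
  "occurrences [a, b] (x # w) = of_bool (w \<noteq> [] \<and> x = a \<and> hd w = b) + occurrences [a, b] w"
proof -
  let ?P = "\<lambda>w. {p. Suc p < length w \<and> w ! p = a \<and> w ! Suc p = b}"
  have "?P (x # w) = (if w \<noteq> [] \<and> x = a \<and> hd w = b then {0} else {}) \<union> Suc ` ?P w"
  proof (intro set_eqI)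
    fix p show "p \<in> ?P (x # w) \<longleftrightarrow>
        p \<in> (if w \<noteq> [] \<and> x = a \<and> hd w = b then {0} else {}) \<union> Suc ` ?P w"
      by (cases p) (auto simp: hd_conv_nth)
  qed
  moreover have "finite (?P w)"
    by (rule finite_subset[of _ "{..<length w}"]) auto
  ultimately show ?thesis
    by (auto simp: occurrences_pair_alt card_image card_insert_if)
qed

text \<open>A word of length two can straddle the cut in only one position, whence the single
  \<open>of_bool\<close> term.\<close>

lemma occurrences_pair_append:
  assumes "u \<noteq> []" "v \<noteq> []"
  shows "occurrences [a, b] (u @ v) =
    occurrences [a, b] u + occurrences [a, b] v + of_bool (last u = a \<and> hd v = b)"
  using assms(1)
proof (induction u)
  case (Cons x u)
  then show ?case
    using assms(2) by (cases "u = []") (auto simp: occurrences_pair_Cons)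
qed simp

lemma occurrences_pair_notin: "b \<notin> set w \<Longrightarrow> occurrences [a, b] w = 0"
  by (induction w) (auto simp: occurrences_pair_Cons)

section \<open>Iterates of the morphism, their first and last letters\<close>

lemma phi_append: "phi k (u @ v) = phi k u @ phi k v"
  by (simp add: phi_def)

lemma funpow_phi_append: "(phi k ^^ n) (u @ v) = (phi k ^^ n) u @ (phi k ^^ n) v"
  by (induction n) (simp_all add: phi_append)

lemma phi_letter_neq_Nil: "phi_letter k x \<noteq> []"
  by (simp add: phi_letter_def Let_def)

lemma phi_neq_Nil: "w \<noteq> [] \<Longrightarrow> phi k w \<noteq> []"
  by (cases w) (simp_all add: phi_def phi_letter_neq_Nil)

text \<open>With \<open>x = k * i + j\<close>, the exceptional image \<open>k * i + k\<close> at
  \<open>j = k - 1\<close> is again \<open>k * i + j + 1\<close>, so both branches end in the same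
  way.\<close>

lemma last_phi_letter:
  assumes "k > 0"
  shows "last (phi_letter k x) = Suc x"
proof (cases "x mod k = k - 1")
  case True
  have "last (phi_letter k x) = k * (x div k) + k"
    using True by (simp add: phi_letter_def Let_def)
  also have "\<dots> = k * (x div k) + Suc (x mod k)"
    using True assms by linarith
  finally show ?thesis
    by simp
qed (simp add: phi_letter_def Let_def)

lemma last_phi:
  assumes "k > 0" "w \<noteq> []"
  shows "last (phi k w) = Suc (last w)"
proof -
  have "phi k w = phi k (butlast w) @ phi k [last w]"
    using assms(2) by (simp flip: phi_append)
  then show ?thesis
    using assms(1) by (simp add: phi_def phi_letter_neq_Nil last_phi_letter)
qed

lemma funpow_phi_neq_Nil: "w \<noteq> [] \<Longrightarrow> (phi k ^^ n) w \<noteq> []"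
  by (induction n) (simp_all add: phi_neq_Nil)

lemma last_W: "k > 0 \<Longrightarrow> last (W k n) = n"
  unfolding W_def by (induction n) (simp_all add: last_phi funpow_phi_neq_Nil)

text \<open>A letter of residue \<open>k - 1\<close> maps to a letter at least \<open>k\<close>; any
  other letter in this range is at least \<open>k\<close> itself, so its block starts at
  \<open>k\<close> or later.\<close>

lemma phi_letter_ge:
  assumes "k > 0" "x \<ge> k - 1" "y \<in> set (phi_letter k x)"
  shows "y \<ge> k - 1"
proof (cases "x mod k = k - 1")
  case True
  then show ?thesis
    using assms(3) by (simp add: phi_letter_def Let_def)
next
  case False
  then have "x \<noteq> k - 1"
    using assms(1) by auto
  then have "k \<le> x"
    using assms(2) by linarith
  then have "k * 1 \<le> k * (x div k)"
    using assms(1) by (intro mult_le_mono2) (simp add: Suc_leI div_greater_zero_iff)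
  moreover have "y = k * (x div k) \<or> y = Suc (k * (x div k) + x mod k)"
    using assms(3) False by (simp add: phi_letter_def Let_def)
  ultimately show ?thesis
    by linarith
qed

lemma set_funpow_phi_ge:
  assumes "k > 0" "x \<in> set ((phi k ^^ n) [k - 1])"
  shows "x \<ge> k - 1"
  using assms(2)
proof (induction n arbitrary: x)
  case (Suc n)
  then obtain z where "z \<in> set ((phi k ^^ n) [k - 1])" "x \<in> set (phi_letter k z)"
    unfolding phi_def[of k "(phi k ^^ n) [k - 1]"] funpow.simps comp_apply set_concat set_map by blast
  then show ?case
    using Suc.IH phi_letter_ge assms(1) by blast
qed simp

lemma zero_notin_funpow_phi: "k \<ge> 2 \<Longrightarrow> 0 \<notin> set ((phi k ^^ n) [k - 1])"
  using set_funpow_phi_ge[of k 0 n] by linarith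

lemma funpow_Suc_phi:
  assumes "j < k - 1"
  shows "(phi k ^^ Suc n) [j] = W k n @ (phi k ^^ n) [Suc j]"
proof -
  have "phi k [j] = [0] @ [Suc j]"
    using assms by (simp add: phi_def phi_letter_def)
  \<comment> \<open>\<open>funpow_Suc_right\<close> peels off the innermost \<open>phi\<close>, so
    that the remaining iterates act on \<open>0\<close> and \<open>Suc j\<close> separately.\<close>
  then show ?thesis
    by (simp only: funpow_Suc_right comp_apply funpow_phi_append W_def)
qed

lemma W_neq_Nil: "W k n \<noteq> []"
  by (simp add: W_def funpow_phi_neq_Nil)

lemma hd_W:
  assumes "k \<ge> 2"
  shows "hd (W k n) = 0"
proof (induction n)
  case (Suc n)
  have "W k (Suc n) = W k n @ (phi k ^^ n) [Suc 0]"
    unfolding W_def[of k "Suc n"] using assms by (intro funpow_Suc_phi) auto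
  with Suc show ?case
    by (simp add: W_neq_Nil)
qed (simp add: W_def)

text \<open>The bound \<open>n > 0\<close> matters: for \<open>n = 0\<close> the head is
  \<open>j\<close> itself, which may be nonzero below \<open>k - 1\<close>.\<close>

lemma hd_funpow_phi_eq_0_iff:
  assumes "k \<ge> 2" "n > 0" "j \<le> k - 1"
  shows "hd ((phi k ^^ n) [j]) = 0 \<longleftrightarrow> j < k - 1"
proof (cases "j < k - 1")
  case True
  obtain m where "n = Suc m"
    using assms(2) gr0_implies_Suc by blast
  then show ?thesis
    using True assms by (simp only: funpow_Suc_phi hd_append hd_W W_neq_Nil) simp
next
  case False
  with assms have "j = k - 1" by simp
  moreover have "hd ((phi k ^^ n) [j]) \<in> set ((phi k ^^ n) [j])"
    by (intro hd_in_set funpow_phi_neq_Nil) simp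
  ultimately have "hd ((phi k ^^ n) [j]) \<noteq> 0"
    using zero_notin_funpow_phi[OF assms(1), of n] by metis
  with False show ?thesis
    by simp
qed

section \<open>Series of the iterates on a single letter\<close>

definition letter_series :: "nat \<Rightarrow> nat \<Rightarrow> nat \<Rightarrow> int fps" where
  "letter_series k a j = Abs_fps (\<lambda>n. int (occurrences [a, 0] ((phi k ^^ n) [j])))"

lemma letter_series_0: "letter_series k a 0 = C k [a, 0]"
  by (simp add: letter_series_def C_def W_def)

lemma letter_series_last: "k \<ge> 2 \<Longrightarrow> letter_series k a (k - 1) = 0"
  by (rule fps_ext) (simp add: letter_series_def occurrences_pair_notin zero_notin_funpow_phi del: One_nat_def)

lemma letter_series_rec:
  assumes "k \<ge> 2" "a > 0" "j < k - 1"
  shows "letter_series k a j =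
    fps_X * (C k [a, 0] + letter_series k a (Suc j) + of_bool (Suc j < k - 1) * fps_X ^ a)"
proof (rule fps_ext)
  fix n
  show "letter_series k a j $ n = (fps_X * (C k [a, 0] + letter_series k a (Suc j) +
    of_bool (Suc j < k - 1) * fps_X ^ a)) $ n"
  proof (cases n)
    case 0
    then show ?thesis
      by (simp add: letter_series_def occurrences_pair_Cons)
  next
    case (Suc m)
    \<comment> \<open>Here \<open>a > 0\<close> enters: \<open>m = a\<close> forces
      \<open>m > 0\<close>, as the criterion for the head requires.\<close>
    have "last (W k m) = a \<and> hd ((phi k ^^ m) [Suc j]) = 0 \<longleftrightarrow> m = a \<and> Suc j < k - 1"
      using assms last_W[of k m] hd_funpow_phi_eq_0_iff[of k m "Suc j"] by auto
    then have "occurrences [a, 0] ((phi k ^^ Suc m) [j]) = occurrences [a, 0] (W k m) +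
        occurrences [a, 0] ((phi k ^^ m) [Suc j]) + of_bool (m = a \<and> Suc j < k - 1)"
      by (simp only: funpow_Suc_phi[OF assms(3)] occurrences_pair_append[OF W_neq_Nil funpow_phi_neq_Nil] list.distinct not_False_eq_True simp_thms)
    then show ?thesis
      unfolding Suc letter_series_def C_def
      by (auto simp del: funpow.simps simp: fps_X_power_nth)
  qed
qed

definition X_sum :: "nat \<Rightarrow> int fps" where
  "X_sum r = (\<Sum>i = 1..r. fps_X ^ i)"

lemma X_sum_0 [simp]: "X_sum 0 = 0"
  by (simp add: X_sum_def)

lemma X_sum_Suc: "X_sum (Suc r) = fps_X * (1 + X_sum r)"
proof -
  have "X_sum (Suc r) = fps_X ^ 1 + (\<Sum>i = Suc 1..Suc r. fps_X ^ i)"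
    unfolding X_sum_def by (rule sum.atLeast_Suc_atMost) simp
  also have "(\<Sum>i = Suc 1..Suc r. fps_X ^ i) = fps_X * X_sum r"
    by (simp only: sum.shift_bounds_cl_Suc_ivl X_sum_def sum_distrib_left power_Suc)
  finally show ?thesis
    by (simp add: algebra_simps)
qed

lemma X_sum_nth: "X_sum r $ n = of_bool (1 \<le> n \<and> n \<le> r)"
  by (simp add: X_sum_def fps_sum_nth fps_X_power_nth)

text \<open>Induction on the distance \<open>r\<close> to the letter \<open>k - 1\<close> starts
  from the zero series. The first step away from it adds no straddling occurrence, so the second sum
  lags behind by one.\<close>

lemma letter_series_closed:
  assumes "k \<ge> 2" "a > 0" "r \<le> k - 1"
  shows "letter_series k a (k - 1 - r) = X_sum r * C k [a, 0] + X_sum (r - 1) * fps_X ^ a"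
  using assms(3)
proof (induction r)
  case 0
  show ?case
    using letter_series_last[OF assms(1)] by simp
next
  case (Suc r)
  have "Suc (k - 1 - Suc r) = k - 1 - r" "k - 1 - r < k - 1 \<longleftrightarrow> r \<noteq> 0"
    using Suc.prems by auto
  then have "letter_series k a (k - 1 - Suc r) = fps_X * (C k [a, 0] +
      (X_sum r * C k [a, 0] + X_sum (r - 1) * fps_X ^ a) + of_bool (r \<noteq> 0) * fps_X ^ a)"
    using letter_series_rec[of k a "k - 1 - Suc r"] Suc assms(1,2) by simp
  also have "\<dots> = X_sum (Suc r) * C k [a, 0] + X_sum (Suc r - 1) * fps_X ^ a"
    \<comment> \<open>The truncated \<open>r - 1\<close> makes \<open>r = 0\<close> a separate case;
      there \<open>of_bool (r \<noteq> 0)\<close> vanishes too.\<close>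
    by (cases r) (simp_all add: X_sum_Suc algebra_simps)
  finally show ?case .
qed

section \<open>The functional equation of \<open>G\<close>\<close>

lemma sum_g_initial: "n < m \<Longrightarrow> (\<Sum>i = 1..Suc n. g m (Suc n - i)) + 1 = 2 ^ n"
proof (induction n)
  case (Suc n)
  have "(\<Sum>i = 1..Suc (Suc n). g m (Suc (Suc n) - i)) =
      g m (Suc n) + (\<Sum>i = Suc 1..Suc (Suc n). g m (Suc (Suc n) - i))"
    by (subst sum.atLeast_Suc_atMost) auto
  also have "(\<Sum>i = Suc 1..Suc (Suc n). g m (Suc (Suc n) - i)) = (\<Sum>i = 1..Suc n. g m (Suc n - i))"
    by (simp only: sum.shift_bounds_cl_Suc_ivl diff_Suc_Suc)
  finally show ?case
    using Suc by (simp add: g.simps[of m "Suc n"])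
qed (simp add: g.simps)

text \<open>For \<open>0 < n < m\<close> the recurrence, cut off at index \<open>0\<close>, yields
  only \<open>2 ^ (n - 1) - 1\<close>, and \<open>X_sum (m - 1)\<close> supplies the missing one.
  From \<open>n = m\<close> on it is exact.\<close>

lemma G_eq: "m > 0 \<Longrightarrow> G m = X_sum m * G m + X_sum (m - 1)"
proof (rule fps_ext)
  fix n
  assume "m > 0"
  have "(X_sum m * G m) $ n = (\<Sum>i = 1..m. if n < i then 0 else G m $ (n - i))"
    by (simp add: X_sum_def sum_distrib_right fps_sum_nth fps_X_power_mult_nth)
  also have "\<dots> = (\<Sum>i = 1..min m n. int (g m (n - i)))"
    by (intro sum.mono_neutral_cong_right) (auto simp: G_def)
  finally have prod: "(X_sum m * G m) $ n = int (\<Sum>i = 1..min m n. g m (n - i))"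
    by simp
  consider "n = 0" | l where "n = Suc l" "n < m" | "n \<ge> m" "n > 0"
    by (cases n) (auto simp: not_less[symmetric])
  then show "G m $ n = (X_sum m * G m + X_sum (m - 1)) $ n"
  proof cases
    case 1
    then show ?thesis
      unfolding fps_add_nth prod by (simp add: G_def X_sum_nth g.simps)
  next
    case 2
    then have "g m n = (\<Sum>i = 1..min m n. g m (n - i)) + 1"
      using sum_g_initial[of l m] g.simps[of m n] by simp
    with 2 show ?thesis
      unfolding fps_add_nth prod by (simp add: G_def X_sum_nth)
  next
    case 3
    then have "g m n = (\<Sum>i = 1..min m n. g m (n - i))"
      using g.simps[of m n] by simp
    with 3 \<open>m > 0\<close> show ?thesis
      unfolding fps_add_nth prod by (simp add: G_def X_sum_nth)
  qed
qed

theorem theorem5p9: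
  fixes k a :: nat
  assumes "k \<ge> 3" and "a \<ge> 1"
  shows "C k [a, 0] = fps_X ^ a * G (k - 1)"
proof -
  let ?S = "X_sum (k - 1)" and ?T = "X_sum (k - 1 - 1)"
  have C: "C k [a, 0] = ?S * C k [a, 0] + ?T * fps_X ^ a"
    using letter_series_closed[of k a "k - 1"] assms by (simp add: letter_series_0)
  have G: "G (k - 1) = ?S * G (k - 1) + ?T"
    using assms by (intro G_eq) simp
  have "(1 - ?S) * C k [a, 0] = ?T * fps_X ^ a"
    using C by (simp add: algebra_simps)
  also have "?T = (1 - ?S) * G (k - 1)"
    using G by (simp add: algebra_simps)
  also have "\<dots> * fps_X ^ a = (1 - ?S) * (fps_X ^ a * G (k - 1))"
    by (simp only: mult_ac)
  finally have "(1 - ?S) * C k [a, 0] = (1 - ?S) * (fps_X ^ a * G (k - 1))" .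
  \<comment> \<open>The factor can be cancelled: \<open>int fps\<close> is an integral domain, and a
    series with constant term \<open>1\<close> is nonzero.\<close>
  moreover have "(1 - ?S) $ 0 = 1"
    by (simp add: X_sum_nth)
  then have "1 - ?S \<noteq> 0"
    by fastforce
  ultimately show ?thesis
    by simp
qed

end
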